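(* Let $K$ be a closed convex cone in a real Hilbert space $X$. Suppose that at least one of the following conditions holds true. (i) $K$ has nonempty interior, $a_1,\ldots,a_n\in X$, $b_1,\ldots,b_n>0$, and $B:=\{x\in X:\langle a_i,x\rangle\le b_i,\ i=1,\ldots,n\}$. (ii) $K$ has nonempty interior, $a\in X$, $a\notin K^-$, $b\in\mathbb{R}$, and $B:=\{x\in X:\langle a,x\rangle\ge b\}$. (iii) $a$ belongs to the interior of $K^-$ and $B:=\{x\in X:\langle a,x\rangle\ge 0\}$. Then the couple $(K,B)$ is stable.
   Context: A subset $K$ of $X$ is a cone if $\lambda k\in K$ whenever $\lambda\in[0,\infty)$ and $k\in K$ (cones are nonempty). The negative polar cone of $K$ is $K^-=\{x\in X:\langle x,k\rangle\le 0\ \text{for all } k\in K\}$. For a nonempty closed convex set $C\subset X$, $P_C$ denotes the metric projection onto $C$. Perturbed alternating projections sequences: given $a_0\in X$ and sequences $\{A_n\},\{B_n\}$ of nonempty closed convex sets, they are defined inductively by $b_n=P_{B_n}(a_{n-1})$ and $a_n=P_{A_n}(b_n)$ for $n\in\mathbb{N}=\{1,2,\dots\}$. Attouch-Wets convergence: let $B_X$ be the closed unit ball. For nonempty closed $A,C\subset X$ and $N\in\mathbb{N}$ put $e_N(A,C)=\sup\{\mathrm{dist}(a,C): a\in A,\ \|a\|\le N\}$ (equal to $0$ if $A\cap NB_X=\emptyset$) and $h_N(A,C)=\max\{e_N(A,C),e_N(C,A)\}$. A sequence $\{A_n\}$ of nonempty closed sets Attouch-Wets converges to the nonempty closed set $A$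 if $\lim_n h_N(A_n,A)=0$ for every $N\in\mathbb{N}$. Stability: let $A,B$ be closed convex subsets of $X$ with $A\cap B\neq\emptyset$. The couple $(A,B)$ is stable if for each choice of sequences $\{A_n\},\{B_n\}$ of nonempty closed convex sets converging for the Attouch-Wets convergence to $A$ and $B$, respectively, and for each choice of the starting point $a_0\in X$, the corresponding perturbed alternating projections sequences $\{a_n\}$ and $\{b_n\}$ converge in norm. *)

theory Defs
  imports "HOL-Analysis.Analysis"
begin

definition neg_polar :: "'a::real_inner set \<Rightarrow> 'a set"
  where "neg_polar K = {x. \<forall>k\<in>K. inner x k \<le> 0}"

text \<open>The library's \<^verbatim>\<open>closest_point\<close> is confined to class \<^verbatim>\<open>heine_borel\<close>, i.e. to finite
  dimension, so the metric projection is introduced here. The description denotes whenever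
  \<^verbatim>\<open>C\<close> is a nonempty closed convex subset of a Hilbert space.\<close>

definition metric_proj :: "'a::real_inner set \<Rightarrow> 'a \<Rightarrow> 'a"
  where "metric_proj C x = (THE p. p \<in> C \<and> (\<forall>y\<in>C. dist x p \<le> dist x y))"

text \<open>The truncated excess \<^verbatim>\<open>e_N(A,C)\<close>. For \<^verbatim>\<open>C\<close> nonempty, the supremum below is over a set bounded
  by \<^verbatim>\<open>N + infdist 0 C\<close>, so the real-valued supremum is the true one; the supremum over the
  empty set, unspecified on the reals, is fixed to be 0.\<close>

definition excess :: "nat \<Rightarrow> 'a::real_normed_vector set \<Rightarrow> 'a set \<Rightarrow> real"
  where "excess N A C =
    (if A \<inter> cball 0 (real N) = {} then 0
     else (SUP a\<in>A \<inter> cball 0 (real N). infdist a C))"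

definition aw_gap :: "nat \<Rightarrow> 'a::real_normed_vector set \<Rightarrow> 'a set \<Rightarrow> real"
  where "aw_gap N A C = max (excess N A C) (excess N C A)"

text \<open>Sequences are indexed by 1, 2, ...; the sets with index 0 play no role here or below.\<close>

definition aw_converges :: "(nat \<Rightarrow> 'a::real_normed_vector set) \<Rightarrow> 'a set \<Rightarrow> bool"
  where "aw_converges S A \<longleftrightarrow> (\<forall>N\<ge>1. (\<lambda>n. aw_gap N (S n) A) \<longlonglongrightarrow> 0)"

text \<open>\<^verbatim>\<open>a 0\<close> is the starting point, while \<^verbatim>\<open>b 0\<close> is an unconstrained dummy.\<close>

definition perturbed_ap ::
  "(nat \<Rightarrow> 'a::real_inner set) \<Rightarrow> (nat \<Rightarrow> 'a set) \<Rightarrow> 'a \<Rightarrow> (nat \<Rightarrow> 'a) \<Rightarrow> (nat \<Rightarrow> 'a) \<Rightarrow> bool"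
  where "perturbed_ap S T a0 a b \<longleftrightarrow> a 0 = a0 \<and>
    (\<forall>n\<ge>1. b n = metric_proj (T n) (a (n - 1)) \<and> a n = metric_proj (S n) (b n))"

text \<open>The standing requirements on the couple are part of the definition, so stability of a
  couple includes the assertion that the notion applies to it.\<close>

definition stable_couple :: "'a::{real_inner,complete_space} set \<Rightarrow> 'a set \<Rightarrow> bool"
  where "stable_couple A B \<longleftrightarrow>
    closed A \<and> convex A \<and> closed B \<and> convex B \<and> A \<inter> B \<noteq> {} \<and>
    (\<forall>S T a0 a b.
      (\<forall>n\<ge>1. S n \<noteq> {} \<and> closed (S n) \<and> convex (S n)) \<longrightarrow>
      (\<forall>n\<ge>1. T n \<noteq> {} \<and> closed (T n) \<and> convex (T n)) \<longrightarrow>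
      aw_converges S A \<longrightarrow> aw_converges T B \<longrightarrow>
      perturbed_ap S T a0 a b \<longrightarrow>
      convergent a \<and> convergent b)"

end

theory Submission
  imports Defs
begin

text \<open>The first two conditions make the interior of \<^term>\<open>K \<inter> B\<close> nonempty, since a ball in the
  cone \<^term>\<open>K\<close> can be shrunk towards the origin or translated far along a ray of \<^term>\<open>K\<close>. Under
  Attouch-Wets convergence a ball inside the limit persists, with half its radius, in the
  approximating convex sets (\<open>aw_converges_eventually_cball_subset\<close>). So all projections
  are eventually onto sets containing one fixed ball, say of centre \<open>c\<close> and radius \<open>r\<close>. Projecting
  \<open>x\<close> onto such a set reduces the squared distance to \<open>c\<close> by at least \<open>2 r\<close> times the
  displacement of \<open>x\<close> (\<open>metric_proj_ball_gain\<close>). The displacements are therefore summable and the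
  iterates converge.

  In the third condition \<^term>\<open>K\<close> and \<^term>\<open>B\<close> meet only at 0, and at a positive angle: there is
  \<open>\<epsilon> > 0\<close> with \<open>\<langle>a, k\<rangle> \<le> - \<epsilon> \<parallel>k\<parallel>\<close> on \<^term>\<open>K\<close>, whereas \<open>\<langle>a, x\<rangle> \<ge> 0\<close> on
  \<^term>\<open>B\<close>. Although Attouch-Wets convergence is a statement about bounded sets, convexity carries
  both inequalities over to all points \<open>x\<close> of the approximating sets, up to an error
  \<open>\<delta> (1 + \<parallel>x\<parallel>)\<close> (\<open>aw_converges_eventually_conical_bound\<close>). Hence, unless \<open>a\<^sub>n\<close> is
  already small, the step from \<open>a\<^sub>n\<close> to \<open>b\<^sub>n\<^sub>+\<^sub>1\<close> is at least a fixed multiple of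
  \<open>\<parallel>a\<^sub>n\<parallel>\<close>, and the Pythagorean inequality for projections turns this into a contraction of the
  norm by a fixed factor. Both sequences then converge to 0.\<close>

section \<open>The metric projection in a Hilbert space\<close>

text \<open>By the parallelogram law the sets of almost nearest points have diameter tending to 0,
  so completeness gives a nearest point.\<close>

lemma nearest_point_exists:
  fixes C :: "'a::{real_inner,complete_space} set"
  assumes "closed C" "convex C" "C \<noteq> {}"
  shows "\<exists>p\<in>C. \<forall>y\<in>C. dist x p \<le> dist x y"
proof -
  define d where "d = infdist x C"
  have d0: "d \<ge> 0" by (simp add: d_def infdist_nonneg)
  have dle: "d \<le> dist x y" if "y \<in> C" for y
    using that by (simp add: d_def infdist_le)
  define F where "F = (\<lambda>n::nat. C \<inter> cball x (d + 1 / real (Suc n)))"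
  have clF: "closed (F n)" for n
    unfolding F_def using assms(1) by (intro closed_Int) auto
  have neF: "F n \<noteq> {}" for n
  proof -
    have "(INF y\<in>C. dist x y) < d + 1 / real (Suc n)"
      using assms(3) by (simp add: d_def infdist_notempty)
    then obtain y where "y \<in> C" "dist x y < d + 1 / real (Suc n)"
      using assms(3) by (auto simp: cINF_less_iff)
    then show ?thesis unfolding F_def by (auto intro!: exI[of _ y])
  qed
  have decF: "F n \<subseteq> F m" if "m \<le> n" for m n
  proof -
    have "1 / real (Suc n) \<le> 1 / real (Suc m)" using that by (simp add: frac_le)
    then show ?thesis unfolding F_def by auto
  qed
  have diam: "(dist y z)\<^sup>2 \<le> (8 * d + 4) * (1 / real (Suc n))"
    if "y \<in> F n" "z \<in> F n" for y z n
  proof -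
    define t where "t = 1 / real (Suc n)"
    have t: "0 < t" "t \<le> 1" unfolding t_def by auto
    have y: "y \<in> C" "dist x y \<le> d + t" and z: "z \<in> C" "dist x z \<le> d + t"
      using that unfolding F_def t_def by auto
    have "(1/2) *\<^sub>R y + (1/2) *\<^sub>R z \<in> C"
      using convexD[OF assms(2) y(1) z(1), of "1/2" "1/2"] by simp
    then have m: "d \<le> norm (x - ((1/2) *\<^sub>R y + (1/2) *\<^sub>R z))"
      using dle by (simp add: dist_norm)
    have "(dist y z)\<^sup>2 = 2 * (dist x y)\<^sup>2 + 2 * (dist x z)\<^sup>2
        - 4 * (norm (x - ((1/2) *\<^sub>R y + (1/2) *\<^sub>R z)))\<^sup>2"
      unfolding dist_norm power2_norm_eq_inner
      by (simp add: inner_simps inner_commute algebra_simps)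
    also have "\<dots> \<le> 2 * (d + t)\<^sup>2 + 2 * (d + t)\<^sup>2 - 4 * d\<^sup>2"
      using power_mono[OF y(2) zero_le_dist, of 2] power_mono[OF z(2) zero_le_dist, of 2]
        power_mono[OF m d0, of 2] by linarith
    also have "\<dots> = 8 * d * t + 4 * (t * t)" by (simp add: power2_eq_square algebra_simps)
    also have "\<dots> \<le> 8 * d * t + 4 * t" using t by (simp add: mult_left_le)
    finally show ?thesis unfolding t_def[symmetric] by (simp add: algebra_simps)
  qed
  have small: "\<exists>n. \<forall>y\<in>F n. \<forall>z\<in>F n. dist y z < e" if "e > 0" for e
  proof -
    have "(\<lambda>n. (8 * d + 4) * (1 / real (Suc n))) \<longlonglongrightarrow> (8 * d + 4) * 0"
      by (intro tendsto_mult tendsto_const lim_1_over_n[THEN LIMSEQ_Suc])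
    then have "eventually (\<lambda>n. (8 * d + 4) * (1 / real (Suc n)) < e\<^sup>2) sequentially"
      using that by (intro order_tendstoD(2)) auto
    then obtain n where "(8 * d + 4) * (1 / real (Suc n)) < e\<^sup>2"
      by (auto simp: eventually_sequentially)
    then have "(dist y z)\<^sup>2 < e\<^sup>2" if "y \<in> F n" "z \<in> F n" for y z
      using diam[OF that] by linarith
    then show ?thesis using that by (meson less_imp_le power2_less_imp_less)
  qed
  obtain p where p: "\<And>n. p \<in> F n"
    using decreasing_closed_nest[of F, OF clF neF decF small] by blast
  have "dist x p \<le> d + e" if e: "e > 0" for e
  proof -
    obtain n where "1 / real (Suc n) < e" using nat_approx_posE[OF e] by blast
    moreover have "dist x p \<le> d + 1 / real (Suc n)" using p[of n] by (simp add: F_def)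
    ultimately show ?thesis by linarith
  qed
  then have "dist x p \<le> d" by (rule field_le_epsilon)
  then show ?thesis using p[of 0] dle unfolding F_def by force
qed

lemma metric_proj_in_and_dot:
  fixes C :: "'a::{real_inner,complete_space} set"
  assumes "closed C" "convex C" "C \<noteq> {}"
  shows metric_proj_in: "metric_proj C x \<in> C"
    and metric_proj_dot: "y \<in> C \<Longrightarrow> inner (x - metric_proj C x) (y - metric_proj C x) \<le> 0"
proof -
  obtain p where p: "p \<in> C" "\<forall>y\<in>C. dist x p \<le> dist x y"
    using nearest_point_exists[OF assms] by blast
  then have "metric_proj C x = p"
    unfolding metric_proj_def
    by (intro the_equality) (auto intro: any_closest_point_unique[OF assms(2,1)])
  then show "metric_proj C x \<in> C"
    and "y \<in> C \<Longrightarrow> inner (x - metric_proj C x) (y - metric_proj C x) \<le> 0"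
    using p any_closest_point_dot[OF assms(2,1)] by auto
qed

lemma metric_proj_pythagoras:
  fixes C :: "'a::{real_inner,complete_space} set"
  assumes "closed C" "convex C" "y \<in> C"
  shows "(norm (metric_proj C x - y))\<^sup>2 + (norm (x - metric_proj C x))\<^sup>2 \<le> (norm (x - y))\<^sup>2"
proof -
  have "inner (x - metric_proj C x) (y - metric_proj C x) \<le> 0"
    using assms by (intro metric_proj_dot) auto
  then show ?thesis
    unfolding power2_norm_eq_inner by (simp add: inner_simps inner_commute algebra_simps)
qed

lemma inner_sgn_eq_norm: "inner (sgn x) x = norm x"
proof -
  have "inner (sgn x) x = (norm x * norm x) / norm x"
    by (simp add: sgn_div_norm dot_square_norm power2_eq_square divide_inverse_commute)
  then show ?thesis by simp
qed

text \<open>If \<^term>\<open>C\<close> contains a ball, the variational inequality can be tested at the point of the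
  ball furthest in the direction \<^term>\<open>x - metric_proj C x\<close>. The gain over the usual
  nonexpansiveness towards the centre is linear in the displacement, hence summable along
  successive projections.\<close>

lemma metric_proj_ball_gain:
  fixes C :: "'a::{real_inner,complete_space} set"
  assumes "closed C" "convex C" "cball c r \<subseteq> C" "r > 0"
  shows "2 * r * dist x (metric_proj C x) \<le> (dist x c)\<^sup>2 - (dist (metric_proj C x) c)\<^sup>2"
proof -
  define p where "p = metric_proj C x"
  define u where "u = sgn (x - p)"
  have ne: "C \<noteq> {}" using assms(3,4) by auto
  have nu: "norm u \<le> 1" by (simp add: u_def norm_sgn)
  have "c + r *\<^sub>R u \<in> C"
    using assms(3,4) nu by (intro subsetD[OF assms(3)]) (simp add: dist_norm mult_left_le)
  then have "inner (x - p) (c + r *\<^sub>R u - p) \<le> 0"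
    unfolding p_def by (rule metric_proj_dot[OF assms(1,2) ne])
  moreover have "inner (x - p) u = norm (x - p)"
    by (simp only: u_def inner_commute[of "x - p"] inner_sgn_eq_norm)
  ultimately have "inner (x - p) (c - p) + r * norm (x - p) \<le> 0"
    by (simp add: inner_simps)
  moreover have "(norm (x - c))\<^sup>2 - (norm (p - c))\<^sup>2
      = (norm (x - p))\<^sup>2 - 2 * inner (x - p) (c - p)"
    unfolding power2_norm_eq_inner by (simp add: inner_simps inner_commute algebra_simps)
  moreover have "(norm (x - p))\<^sup>2 \<ge> 0" by simp
  ultimately show ?thesis
    unfolding dist_norm p_def[symmetric] by linarith
qed

section \<open>Attouch-Wets convergence\<close>

lemma infdist_le_excess:
  assumes "x \<in> A" "norm x \<le> real N"
  shows "infdist x C \<le> excess N A C"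
proof -
  have "bdd_above ((\<lambda>a. infdist a C) ` (A \<inter> cball 0 (real N)))"
  proof (rule bdd_aboveI2)
    fix a assume "a \<in> A \<inter> cball 0 (real N)"
    then show "infdist a C \<le> infdist 0 C + real N"
      using infdist_triangle[of a C 0] by (auto simp: dist_norm)
  qed
  then have "infdist x C \<le> (SUP a\<in>A \<inter> cball 0 (real N). infdist a C)"
    using assms by (intro cSUP_upper) auto
  moreover have "A \<inter> cball 0 (real N) \<noteq> {}" using assms by auto
  ultimately show ?thesis by (simp add: excess_def)
qed

lemma infdist_less_obtain:
  assumes "infdist x C < e" "C \<noteq> {}"
  obtains y where "y \<in> C" "dist x y < e"
  using assms by (auto simp: infdist_notempty cINF_less_iff)

lemma aw_converges_eventually_infdist:
  assumes "aw_converges S A" "e > 0"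
  shows "eventually (\<lambda>n. (\<forall>x\<in>S n. norm x \<le> R \<longrightarrow> infdist x A < e) \<and>
                         (\<forall>x\<in>A. norm x \<le> R \<longrightarrow> infdist x (S n) < e)) sequentially"
proof -
  obtain N :: nat where N: "N \<ge> 1" "R \<le> real N"
    using real_arch_simple[of "max R 1"] by auto
  have "eventually (\<lambda>n. aw_gap N (S n) A < e) sequentially"
    using assms N(1) unfolding aw_converges_def by (intro order_tendstoD(2)[where y=0]) auto
  then show ?thesis
  proof eventually_elim
    case (elim n)
    then have "excess N (S n) A < e" "excess N A (S n) < e"
      by (auto simp: aw_gap_def)
    then show ?case
      using N(2) infdist_le_excess[of _ "S n" N A] infdist_le_excess[of _ A N "S n"]
      by (meson order.trans le_less_trans)
  qed
qed

lemma aw_converges_eventually_near: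
  assumes "aw_converges S A" "\<And>n. n \<ge> 1 \<Longrightarrow> S n \<noteq> {}" "x \<in> A" "e > 0"
  shows "eventually (\<lambda>n. \<exists>z\<in>S n. dist x z < e) sequentially"
  using aw_converges_eventually_infdist[OF assms(1,4), of "norm x"] eventually_ge_at_top[of 1]
proof eventually_elim
  case (elim n)
  then have "infdist x (S n) < e" "S n \<noteq> {}" using assms(2,3) by auto
  then show ?case by (metis infdist_less_obtain)
qed

text \<open>A point of the ball outside \<^term>\<open>S n\<close> can be pushed away from its projection on
  \<^term>\<open>S n\<close> by a distance \<^term>\<open>r\<close> while staying in \<^term>\<open>A\<close>; the excess of \<^term>\<open>A\<close> over
  \<^term>\<open>S n\<close> is then at least \<^term>\<open>r\<close>.\<close>

lemma aw_converges_eventually_cball_subset: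
  fixes S :: "nat \<Rightarrow> 'a::{real_inner,complete_space} set"
  assumes aw: "aw_converges S A"
    and S: "\<And>n. n \<ge> 1 \<Longrightarrow> S n \<noteq> {} \<and> closed (S n) \<and> convex (S n)"
    and A: "cball c (2 * r) \<subseteq> A" and r: "r > 0"
  shows "eventually (\<lambda>n. cball c r \<subseteq> S n) sequentially"
  using aw_converges_eventually_infdist[OF aw r, of "norm c + 2 * r"] eventually_ge_at_top[of 1]
proof eventually_elim
  case (elim n)
  have Sn: "S n \<noteq> {}" "closed (S n)" "convex (S n)" using S elim(2) by auto
  show ?case
  proof (rule ccontr)
    assume "\<not> cball c r \<subseteq> S n"
    then obtain z where z: "dist c z \<le> r" "z \<notin> S n" by (metis subsetI mem_cball)
    define p where "p = metric_proj (S n) z"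
    define u where "u = sgn (z - p)"
    have "p \<in> S n" unfolding p_def by (rule metric_proj_in[OF Sn(2,3,1)])
    then have "z \<noteq> p" using z(2) by auto
    then have nu: "norm u = 1" by (simp add: u_def norm_sgn)
    have up: "inner u (z - p) = norm (z - p)"
      unfolding u_def by (rule inner_sgn_eq_norm)
    define w where "w = z + r *\<^sub>R u"
    have "dist c w \<le> 2 * r"
      using dist_triangle[of c w z] z(1) r nu by (simp add: w_def dist_norm)
    then have "w \<in> A" "norm w \<le> norm c + 2 * r"
      using A norm_triangle_ineq[of c "w - c"] by (auto simp: dist_norm norm_minus_commute)
    then have "infdist w (S n) < r" using elim(1) by auto
    then obtain y where y: "y \<in> S n" "dist w y < r"
      using Sn(1) by (rule infdist_less_obtain)
    have "inner (z - p) (y - p) \<le> 0"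
      unfolding p_def by (rule metric_proj_dot[OF Sn(2,3,1) y(1)])
    then have "inner u (y - p) \<le> 0"
      by (simp add: u_def sgn_div_norm mult_nonneg_nonpos)
    then have "r + norm (z - p) \<le> inner u (w - y)"
      using up nu by (simp add: w_def inner_simps power2_norm_eq_inner[symmetric])
    also have "\<dots> \<le> norm (w - y)"
      using norm_cauchy_schwarz[of u "w - y"] nu by simp
    finally have "r \<le> norm (w - y)" using norm_ge_zero[of "z - p"] by linarith
    then show False using y(2) by (simp add: dist_norm)
  qed
qed

text \<open>A bound on a conical function near the origin propagates to the whole of a convex set:
  shrink a far point towards a point of the set close to 0. In this way convergence on one
  bounded set controls the sets everywhere.\<close>

lemma aw_converges_eventually_conical_bound:
  fixes S :: "nat \<Rightarrow> 'a::real_inner set"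
  assumes aw: "aw_converges S A" and S: "\<And>n. n \<ge> 1 \<Longrightarrow> S n \<noteq> {} \<and> convex (S n)"
    and A: "0 \<in> A" "\<And>x. x \<in> A \<Longrightarrow> inner c x + \<epsilon> * norm x \<le> 0" and \<epsilon>: "\<epsilon> \<ge> 0" and \<delta>: "\<delta> > 0"
  shows "eventually (\<lambda>n. \<forall>x\<in>S n. inner c x + \<epsilon> * norm x \<le> \<delta> * (1 + norm x)) sequentially"
proof -
  define g where "g = (\<lambda>x::'a. inner c x + \<epsilon> * norm x)"
  define L where "L = norm c + \<epsilon> + 1"
  have L: "L > 0" using \<epsilon> by (simp add: L_def add_nonneg_pos)
  have g_add: "g (x + y) \<le> g x + L * norm y" for x y
  proof -
    have "inner c y \<le> norm c * norm y" by (rule norm_cauchy_schwarz)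
    moreover have "\<epsilon> * norm (x + y) \<le> \<epsilon> * (norm x + norm y)"
      using \<epsilon> by (intro mult_left_mono norm_triangle_ineq) auto
    ultimately show ?thesis
      using norm_ge_zero[of y] unfolding g_def L_def inner_add_right ring_distribs by linarith
  qed
  have g_scale: "g (t *\<^sub>R x) = t * g x" if "t \<ge> 0" for t x
    using that by (simp add: g_def algebra_simps)
  define e where "e = min 1 (\<delta> / (2 * L))"
  have e: "0 < e" "e \<le> 1" "2 * (L * e) \<le> \<delta>"
    using \<delta> L by (auto simp: e_def min_def field_simps)
  have "eventually (\<lambda>n. \<exists>z\<in>S n. dist 0 z < e) sequentially"
    using S by (intro aw_converges_eventually_near[OF aw _ A(1) e(1)]) auto
  then show ?thesis
    using aw_converges_eventually_infdist[OF aw e(1), of 2] eventually_ge_at_top[of 1]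
  proof (eventually_elim)
    case (elim n)
    obtain z where z: "z \<in> S n" "norm z < e" using elim(1) by auto
    have near: "g w \<le> L * e" if w: "w \<in> S n" "norm w \<le> 2" for w
    proof -
      have "infdist w A < e" "A \<noteq> {}" using elim(2) w A(1) by auto
      then obtain k where k: "k \<in> A" "dist w k < e" by (rule infdist_less_obtain)
      have "g w \<le> g k + L * norm (w - k)" using g_add[of k "w - k"] by simp
      also have "\<dots> \<le> 0 + L * e"
        using A(2)[OF k(1)] k(2) L by (intro add_mono mult_left_mono) (auto simp: g_def dist_norm)
      finally show ?thesis by simp
    qed
    show ?case
    proof
      fix x assume x: "x \<in> S n"
      have "g x \<le> \<delta> * (1 + norm x)"
      proof (cases "norm x \<le> 1")
        case True
        then have "g x \<le> L * e" using near[OF x] by simp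
        moreover have "0 < L * e" using L e(1) by simp
        moreover have "\<delta> \<le> \<delta> * (1 + norm x)" using \<delta> by simp
        ultimately show ?thesis using e(3) by linarith
      next
        case False
        define t where "t = 1 / norm x"
        have t: "0 < t" "t \<le> 1" "t * norm x = 1" using False by (auto simp: t_def divide_le_eq_1)
        define w where "w = (1 - t) *\<^sub>R z + t *\<^sub>R x"
        have "w \<in> S n"
          unfolding w_def using S[OF elim(3)] z(1) x t by (intro convexD_alt) auto
        moreover have nz: "norm ((1 - t) *\<^sub>R z) \<le> e"
          using t z(2) mult_mono[of "1 - t" 1 "norm z" e] by simp
        moreover have "norm w \<le> 2"
          using norm_triangle_ineq[of "(1 - t) *\<^sub>R z" "t *\<^sub>R x"] nz t e(2) by (simp add: w_def)
        ultimately have "g w \<le> L * e" by (intro near)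
        have "t * g x = g (w + - ((1 - t) *\<^sub>R z))" using g_scale t by (simp add: w_def)
        also have "\<dots> \<le> g w + L * norm ((1 - t) *\<^sub>R z)" using g_add[of w "- ((1 - t) *\<^sub>R z)"] by simp
        also have "\<dots> \<le> L * e + L * e"
          using \<open>g w \<le> L * e\<close> nz L by (intro add_mono mult_left_mono) auto
        also have "\<dots> \<le> \<delta>" using e(3) by simp
        finally have "norm x * (t * g x) \<le> norm x * \<delta>" by (intro mult_left_mono) auto
        moreover have "norm x * (t * g x) = g x" using t(3) by (simp flip: mult.assoc add: mult.commute[of "norm x"])
        moreover have "norm x * \<delta> \<le> \<delta> * (1 + norm x)" using \<delta> by (simp add: algebra_simps)
        ultimately show ?thesis by linarith
      qed
      then show "inner c x + \<epsilon> * norm x \<le> \<delta> * (1 + norm x)" by (simp add: g_def)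
    qed
  qed
qed

section \<open>Intersections with nonempty interior\<close>

lemma convergent_if_dist_telescopes:
  fixes a :: "nat \<Rightarrow> 'a::complete_space" and f :: "nat \<Rightarrow> real"
  assumes step: "\<And>n. n \<ge> N \<Longrightarrow> dist (a n) (a (Suc n)) \<le> f n - f (Suc n)"
    and f: "\<And>n. f n \<ge> 0"
  shows "convergent a" "convergent f"
proof -
  have tel: "dist (a m) (a n) \<le> f m - f n" if "m \<ge> N" "m \<le> n" for m n
    using that(2)
  proof (induction n rule: dec_induct)
    case base
    show ?case by simp
  next
    case (step k)
    then show ?case
      using assms(1)[of k] that(1) dist_triangle[of "a m" "a (Suc k)" "a k"] by linarith
  qed
  have "decseq (\<lambda>n. f (n + N))"
  proof (rule decseq_SucI)
    fix n show "f (Suc n + N) \<le> f (n + N)"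
      using step[of "n + N", OF le_add2] zero_le_dist[of "a (n + N)" "a (Suc (n + N))"]
      unfolding add_Suc by linarith
  qed
  then have "convergent (\<lambda>n. f (n + N))"
    using f by (metis decseq_convergent convergent_def)
  then show cf: "convergent f" by (simp add: convergent_ignore_initial_segment)
  have "Cauchy a"
  proof (rule metric_CauchyI)
    fix e :: real assume "e > 0"
    obtain M where M: "\<And>m n. m \<ge> M \<Longrightarrow> n \<ge> M \<Longrightarrow> dist (f m) (f n) < e"
      using cf \<open>e > 0\<close> by (meson Cauchy_convergent_iff Cauchy_def)
    have *: "dist (a m) (a n) < e" if "m \<ge> max M N" "m \<le> n" for m n
    proof -
      have "dist (a m) (a n) \<le> f m - f n" using tel that by simp
      also have "\<dots> < e" using M[of m n] that by (simp add: dist_real_def)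
      finally show ?thesis .
    qed
    show "\<exists>M. \<forall>m\<ge>M. \<forall>n\<ge>M. dist (a m) (a n) < e"
      using * by (metis dist_commute nle_le)
  qed
  then show "convergent a" by (rule Cauchy_convergent)
qed

lemma perturbed_ap_convergent_if_common_ball:
  fixes S T :: "nat \<Rightarrow> 'a::{real_inner,complete_space} set"
  assumes S: "\<And>n. n \<ge> 1 \<Longrightarrow> S n \<noteq> {} \<and> closed (S n) \<and> convex (S n)"
    and T: "\<And>n. n \<ge> 1 \<Longrightarrow> T n \<noteq> {} \<and> closed (T n) \<and> convex (T n)"
    and ball: "eventually (\<lambda>n. cball c r \<subseteq> S n \<inter> T n) sequentially" and r: "r > 0"
    and ap: "perturbed_ap S T a0 a b"
  shows "convergent a \<and> convergent b"
proof -
  obtain N where N: "\<And>n. n \<ge> N \<Longrightarrow> cball c r \<subseteq> S n \<inter> T n"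
    using ball by (auto simp: eventually_sequentially)
  define f where "f = (\<lambda>n. (dist (a n) c)\<^sup>2 / (2 * r))"
  have step: "dist (a n) (b (Suc n)) + dist (b (Suc n)) (a (Suc n)) \<le> f n - f (Suc n)"
    if "n \<ge> N" for n
  proof -
    have b: "b (Suc n) = metric_proj (T (Suc n)) (a n)"
      and a: "a (Suc n) = metric_proj (S (Suc n)) (b (Suc n))"
      using ap unfolding perturbed_ap_def by force+
    have "2 * r * dist (a n) (b (Suc n)) \<le> (dist (a n) c)\<^sup>2 - (dist (b (Suc n)) c)\<^sup>2"
      unfolding b using T[of "Suc n"] N[of "Suc n"] that r by (intro metric_proj_ball_gain) auto
    moreover have "2 * r * dist (b (Suc n)) (a (Suc n))
        \<le> (dist (b (Suc n)) c)\<^sup>2 - (dist (a (Suc n)) c)\<^sup>2"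
      unfolding a using S[of "Suc n"] N[of "Suc n"] that r by (intro metric_proj_ball_gain) auto
    ultimately have "2 * r * (dist (a n) (b (Suc n)) + dist (b (Suc n)) (a (Suc n)))
        \<le> (dist (a n) c)\<^sup>2 - (dist (a (Suc n)) c)\<^sup>2"
      by (simp add: algebra_simps)
    then have "dist (a n) (b (Suc n)) + dist (b (Suc n)) (a (Suc n))
        \<le> ((dist (a n) c)\<^sup>2 - (dist (a (Suc n)) c)\<^sup>2) / (2 * r)"
      using r by (subst pos_le_divide_eq) (auto simp: mult.commute)
    then show ?thesis unfolding f_def by (simp add: diff_divide_distrib)
  qed
  have d: "dist (a n) (a (Suc n)) \<le> f n - f (Suc n)" if "n \<ge> N" for n
    using step[OF that] dist_triangle[of "a n" "a (Suc n)" "b (Suc n)"] by linarith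
  have f0: "f n \<ge> 0" for n using r by (simp add: f_def)
  have "convergent a" "convergent f"
    using convergent_if_dist_telescopes[of N a f, OF d f0] by auto
  then obtain l m where l: "a \<longlonglongrightarrow> l" and m: "f \<longlonglongrightarrow> m" by (auto simp: convergent_def)
  have fd: "(\<lambda>n. f n - f (Suc n)) \<longlonglongrightarrow> 0"
    using tendsto_diff[OF m LIMSEQ_Suc[OF m]] by simp
  have "(\<lambda>n. a n - b (Suc n)) \<longlonglongrightarrow> 0"
  proof (rule Lim_null_comparison[OF _ fd])
    show "\<forall>\<^sub>F n in sequentially. norm (a n - b (Suc n)) \<le> f n - f (Suc n)"
    proof (rule eventually_sequentiallyI)
      fix n assume "N \<le> n"
      then show "norm (a n - b (Suc n)) \<le> f n - f (Suc n)"
        using step[of n] zero_le_dist[of "b (Suc n)" "a (Suc n)"]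
        unfolding dist_norm by linarith
    qed
  qed
  then have "(\<lambda>n. b (Suc n)) \<longlonglongrightarrow> l" using tendsto_diff[OF l] by force
  then have "b \<longlonglongrightarrow> l" by (rule LIMSEQ_imp_Suc)
  with l show ?thesis by (auto simp: convergent_def)
qed

lemma stable_couple_if_interior_Int_nonempty:
  fixes A B :: "'a::{real_inner,complete_space} set"
  assumes "closed A" "convex A" "closed B" "convex B" "interior (A \<inter> B) \<noteq> {}"
  shows "stable_couple A B"
proof -
  obtain c e where e: "e > 0" "cball c e \<subseteq> A \<inter> B"
    using assms(5) by (metis mem_interior_cball equals0I)
  define r where "r = e / 2"
  have r: "r > 0" "cball c (2 * r) \<subseteq> A" "cball c (2 * r) \<subseteq> B" using e by (auto simp: r_def)
  have "A \<inter> B \<noteq> {}" using e by force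
  moreover have "convergent a \<and> convergent b"
    if S: "\<forall>n\<ge>1. S n \<noteq> {} \<and> closed (S n) \<and> convex (S n)"
      and T: "\<forall>n\<ge>1. T n \<noteq> {} \<and> closed (T n) \<and> convex (T n)"
      and aw: "aw_converges S A" "aw_converges T B" and ap: "perturbed_ap S T a0 a b"
    for S T a0 a b
  proof (rule perturbed_ap_convergent_if_common_ball[OF _ _ _ r(1) ap])
    have "eventually (\<lambda>n. cball c r \<subseteq> S n) sequentially"
      using aw_converges_eventually_cball_subset[OF aw(1) _ r(2,1)] S by blast
    moreover have "eventually (\<lambda>n. cball c r \<subseteq> T n) sequentially"
      using aw_converges_eventually_cball_subset[OF aw(2) _ r(3,1)] T by blast
    ultimately show "eventually (\<lambda>n. cball c r \<subseteq> S n \<inter> T n) sequentially"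
      by eventually_elim auto
  qed (use S T in auto)
  ultimately show ?thesis using assms unfolding stable_couple_def by blast
qed

lemma cone_Int_nhd_interior_nonempty:
  fixes K B :: "'a::real_normed_vector set"
  assumes "convex_cone K" "interior K \<noteq> {}" "0 \<in> interior B"
  shows "interior (K \<inter> B) \<noteq> {}"
proof -
  obtain c r where r: "r > 0" "cball c r \<subseteq> K" using assms(2) by (auto simp: mem_interior_cball)
  obtain e where e: "e > 0" "cball 0 e \<subseteq> B" using assms(3) by (auto simp: mem_interior_cball)
  \<comment> \<open>The factor that shrinks the ball around \<^term>\<open>c\<close> into the ball around 0.\<close>
  define t where "t = e / (norm c + r)"
  have pos: "norm c + r > 0" using r(1) by (simp add: add_nonneg_pos)
  then have t: "t > 0" using e(1) by (simp add: t_def)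
  have "x \<in> K \<inter> B" if "x \<in> cball (t *\<^sub>R c) (t * r)" for x
  proof -
    define y where "y = (1 / t) *\<^sub>R x"
    have x: "x = t *\<^sub>R y" using t by (simp add: y_def)
    have "t * norm (c - y) \<le> t * r"
      using that t unfolding x by (simp add: dist_norm flip: scaleR_diff_right)
    then have y: "norm (c - y) \<le> r" using t by simp
    then have "y \<in> K" using r(2) by (auto simp: dist_norm)
    then have "x \<in> K" unfolding x using assms(1) t by (simp add: convex_cone_iff)
    have "norm y \<le> norm c + r" using y norm_triangle_ineq4[of c "c - y"] by simp
    then have "t * norm y \<le> t * (norm c + r)" using t by (intro mult_left_mono) auto
    moreover have "t * (norm c + r) = e" using pos by (simp add: t_def)
    ultimately have "norm x \<le> e" using t unfolding x by simp
    then show ?thesis using \<open>x \<in> K\<close> e(2) by auto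
  qed
  then have "t *\<^sub>R c \<in> interior (K \<inter> B)"
    unfolding mem_interior_cball using t r(1) by (intro exI[of _ "t * r"]) auto
  then show ?thesis by auto
qed

lemma cone_Int_halfspace_interior_nonempty:
  fixes K :: "'a::real_inner set"
  assumes "convex_cone K" "interior K \<noteq> {}" "a \<notin> neg_polar K"
  shows "interior (K \<inter> {x. inner a x \<ge> \<beta>}) \<noteq> {}"
proof -
  obtain c r where r: "r > 0" "cball c r \<subseteq> K" using assms(2) by (auto simp: mem_interior_cball)
  obtain k where k: "k \<in> K" "inner a k > 0" using assms(3) by (auto simp: neg_polar_def not_le)
  \<comment> \<open>Translation by \<^term>\<open>t *\<^sub>R k\<close> keeps the ball in the cone and moves it across the
    hyperplane.\<close>
  define t where "t = (\<bar>\<beta>\<bar> + \<bar>inner a c\<bar> + norm a * r) / inner a k"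
  have t: "t \<ge> 0" "t * inner a k = \<bar>\<beta>\<bar> + \<bar>inner a c\<bar> + norm a * r"
    using k r(1) by (auto simp: t_def)
  have "x \<in> K \<inter> {x. inner a x \<ge> \<beta>}" if "x \<in> cball (c + t *\<^sub>R k) r" for x
  proof -
    define y where "y = x - t *\<^sub>R k"
    have y: "norm (c - y) \<le> r" using that by (simp add: y_def dist_norm algebra_simps)
    then have "y \<in> K" using r(2) by (auto simp: dist_norm)
    then have "y + t *\<^sub>R k \<in> K" using assms(1) k(1) t(1) by (simp add: convex_cone_iff)
    moreover have "inner a (c - y) \<le> norm a * r"
      using norm_cauchy_schwarz[of a "c - y"] mult_left_mono[OF y norm_ge_zero[of a]] by linarith
    then have "\<beta> \<le> inner a (y + t *\<^sub>R k)" using t(2) by (simp add: inner_simps)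
    ultimately show ?thesis by (simp add: y_def)
  qed
  then have "c + t *\<^sub>R k \<in> interior (K \<inter> {x. inner a x \<ge> \<beta>})"
    unfolding mem_interior_cball using r(1) by (intro exI[of _ r]) auto
  then show ?thesis by auto
qed

section \<open>A cone and a half-space meeting only at the apex\<close>

text \<open>A ball around \<^term>\<open>a\<close> in the polar allows \<^term>\<open>a\<close> to be moved in the direction of
  \<^term>\<open>k\<close>.\<close>

lemma neg_polar_interior_bound:
  fixes K :: "'a::real_inner set"
  assumes "a \<in> interior (neg_polar K)"
  obtains \<epsilon> where "\<epsilon> > 0" "\<And>k. k \<in> K \<Longrightarrow> inner a k + \<epsilon> * norm k \<le> 0"
proof -
  obtain e where e: "e > 0" "cball a e \<subseteq> neg_polar K"
    using assms by (auto simp: mem_interior_cball)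
  have "inner a k + e * norm k \<le> 0" if "k \<in> K" for k
  proof -
    have "a + e *\<^sub>R sgn k \<in> neg_polar K"
      using e(1) by (intro subsetD[OF e(2)]) (simp add: dist_norm norm_sgn)
    then have "inner (a + e *\<^sub>R sgn k) k \<le> 0" using that by (simp add: neg_polar_def)
    then show ?thesis by (simp add: inner_add_left inner_sgn_eq_norm)
  qed
  then show thesis using that e(1) by blast
qed

lemma tendsto_zero_if_contractive_up_to_error:
  fixes r :: "nat \<Rightarrow> real"
  assumes r: "\<And>n. r n \<ge> 0" and \<rho>: "0 \<le> \<rho>" "\<rho> < 1"
    and step: "\<And>\<eta>. \<eta> > 0 \<Longrightarrow> eventually (\<lambda>n. r (Suc n) \<le> \<rho> * r n + \<eta>) sequentially"
  shows "r \<longlonglongrightarrow> 0"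
proof (rule order_tendstoI)
  fix e :: real assume "e > 0"
  define \<eta> where "\<eta> = e * (1 - \<rho>) / 2"
  have "\<eta> > 0" using \<open>e > 0\<close> \<rho> by (simp add: \<eta>_def)
  then obtain N where N: "\<And>n. n \<ge> N \<Longrightarrow> r (Suc n) \<le> \<rho> * r n + \<eta>"
    using step by (auto simp: eventually_sequentially)
  have bound: "r (k + N) \<le> \<rho> ^ k * r N + e / 2" for k
  proof (induction k)
    case 0
    then show ?case using \<open>e > 0\<close> by simp
  next
    case (Suc k)
    have "r (Suc k + N) \<le> \<rho> * r (k + N) + \<eta>" using N by simp
    also have "\<dots> \<le> \<rho> * (\<rho> ^ k * r N + e / 2) + \<eta>"
      using Suc \<rho>(1) by (intro add_right_mono mult_left_mono)
    also have "\<dots> = \<rho> ^ Suc k * r N + e / 2" by (simp add: \<eta>_def field_simps)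
    finally show ?case .
  qed
  have "(\<lambda>k. \<rho> ^ k * r N) \<longlonglongrightarrow> 0"
    using \<rho> by (intro tendsto_mult_left_zero LIMSEQ_power_zero) auto
  then have "eventually (\<lambda>k. \<rho> ^ k * r N < e / 2) sequentially"
    using \<open>e > 0\<close> by (intro order_tendstoD(2)) auto
  then have "eventually (\<lambda>k. r (k + N) < e) sequentially"
  proof eventually_elim
    case (elim k)
    then show ?case using bound[of k] by linarith
  qed
  then show "eventually (\<lambda>n. r n < e) sequentially"
    by (subst (asm) eventually_sequentially_seg[of "\<lambda>n. r n < e"])
next
  fix e :: real assume "e < 0"
  then show "eventually (\<lambda>n. e < r n) sequentially" using r by (simp add: less_le_trans)
qed

text \<open>Here \<^term>\<open>R\<close> stands for the distance to the origin before a projection, \<^term>\<open>s\<close> for the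
  length of the step and \<^term>\<open>p\<close> for the distance after it, the distance now being measured
  from a point within \<^term>\<open>\<delta>\<close> of the origin. The value of \<^term>\<open>\<theta>\<close> is small enough for the error
  \<^term>\<open>\<delta> \<le> \<theta> * R\<close> to cost only a fraction of the gain.\<close>

lemma pythagorean_contraction:
  fixes p s \<kappa> \<theta> R \<delta> :: real
  assumes "p\<^sup>2 + s\<^sup>2 \<le> (R + \<delta>)\<^sup>2" "\<kappa> * R \<le> s" "0 \<le> \<delta>" "\<delta> \<le> \<theta> * R" "0 \<le> R"
    and \<theta>: "\<theta> = \<kappa>\<^sup>2 / 16" and \<kappa>: "0 \<le> \<kappa>" "\<kappa> \<le> 1"
  shows "p \<le> (1 - 6 * \<theta>) * R"
proof -
  have t: "0 \<le> \<theta>" "\<theta> \<le> 1/16" using power_le_one[OF \<kappa>, of 2] by (simp_all add: \<theta>)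
  have "(R + \<delta>)\<^sup>2 \<le> (R + \<theta> * R)\<^sup>2" using assms(3-5) by (intro power_mono) auto
  moreover have "(\<kappa> * R)\<^sup>2 \<le> s\<^sup>2" using assms(2,5) \<kappa> by (intro power_mono) auto
  moreover have "(\<kappa> * R)\<^sup>2 = 16 * \<theta> * R\<^sup>2" by (simp add: \<theta> power_mult_distrib)
  moreover have "(R + \<theta> * R)\<^sup>2 - 16 * \<theta> * R\<^sup>2 \<le> ((1 - 6 * \<theta>) * R)\<^sup>2"
  proof -
    have "((1 - 6 * \<theta>) * R)\<^sup>2 - ((R + \<theta> * R)\<^sup>2 - 16 * \<theta> * R\<^sup>2) = \<theta> * (2 + 35 * \<theta>) * R\<^sup>2"
      by (simp add: power2_eq_square algebra_simps)
    moreover have "\<theta> * (2 + 35 * \<theta>) * R\<^sup>2 \<ge> 0" using t by simp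
    ultimately show ?thesis by linarith
  qed
  ultimately have "p\<^sup>2 \<le> ((1 - 6 * \<theta>) * R)\<^sup>2" using assms(1) by linarith
  then show ?thesis by (rule power2_le_imp_le) (use t assms(5) in auto)
qed

text \<open>The norms of the iterates decrease by a fixed factor up to an error that tends to 0.
  The vector \<^term>\<open>c\<close> may be 0, in which case \<^term>\<open>K\<close> reduces to the origin and the half-space
  is the whole space.\<close>

lemma perturbed_ap_convergent_if_polar_halfspace:
  fixes K :: "'a::{real_inner,complete_space} set"
  assumes S: "\<And>n. n \<ge> 1 \<Longrightarrow> S n \<noteq> {} \<and> closed (S n) \<and> convex (S n)"
    and T: "\<And>n. n \<ge> 1 \<Longrightarrow> T n \<noteq> {} \<and> closed (T n) \<and> convex (T n)"
    and aw: "aw_converges S K" "aw_converges T {x. inner c x \<ge> 0}"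
    and K: "0 \<in> K" "\<And>k. k \<in> K \<Longrightarrow> inner c k + \<epsilon> * norm k \<le> 0" and \<epsilon>: "\<epsilon> > 0"
    and ap: "perturbed_ap S T a0 a b"
  shows "convergent a \<and> convergent b"
proof -
  \<comment> \<open>The maximum with \<^term>\<open>\<epsilon>\<close> keeps \<^term>\<open>M\<close> positive when \<^term>\<open>c = 0\<close> and ensures
    \<^term>\<open>\<kappa> \<le> 1\<close>.\<close>
  define M where "M = max (norm c) \<epsilon>"
  have M: "M > 0" "norm c \<le> M" "\<epsilon> \<le> M" using \<epsilon> by (auto simp: M_def)
  define \<kappa> where "\<kappa> = \<epsilon> / (2 * M)"
  have \<kappa>: "0 < \<kappa>" "\<kappa> \<le> 1" "2 * (\<kappa> * M) = \<epsilon>" using \<epsilon> M by (auto simp: \<kappa>_def field_simps)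
  define \<theta> where "\<theta> = \<kappa>\<^sup>2 / 16"
  have \<theta>: "0 < \<theta>" "\<theta> \<le> 1/16" using \<kappa> power_le_one[of \<kappa> 2] by (auto simp: \<theta>_def)
  have b: "b (Suc n) = metric_proj (T (Suc n)) (a n)"
    and aSuc: "a (Suc n) = metric_proj (S (Suc n)) (b (Suc n))" for n
    using ap unfolding perturbed_ap_def by force+
  have aS: "a n \<in> S n" if "n \<ge> 1" for n
    using that ap S[OF that] metric_proj_in[of "S n" "b n"] unfolding perturbed_ap_def by auto
  have bT: "b n \<in> T n" if "n \<ge> 1" for n
    using that ap T[OF that] metric_proj_in[of "T n" "a (n - 1)"] unfolding perturbed_ap_def by auto
  have main: "eventually (\<lambda>n. norm (a (Suc n)) \<le> (1 - 3 * \<theta>) * norm (a n) + \<eta> \<and>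
      norm (b (Suc n)) \<le> norm (a n) + \<eta>) sequentially" if \<eta>: "\<eta> > 0" for \<eta>
  proof -
    \<comment> \<open>Norms below \<^term>\<open>q\<close> count as small. There one full step adds at most \<^term>\<open>4 * \<delta>\<close>, giving
      a norm below \<^term>\<open>5 * q\<close>. Above \<^term>\<open>q\<close>, the choice of \<^term>\<open>\<delta>\<close> makes every error small
      relative to the norm.\<close>
    define q where "q = \<eta> / 5"
    have q: "q > 0" using \<eta> by (simp add: q_def)
    define \<delta> where "\<delta> = Min {1, \<theta> * q, \<epsilon> * q / (8 * (1 + q)), q}"
    have "\<delta> > 0" using q \<theta> \<epsilon> by (auto simp: \<delta>_def)
    have \<delta>: "\<delta> \<le> 1" "\<delta> \<le> \<theta> * q" "\<delta> \<le> \<epsilon> * q / (8 * (1 + q))" "\<delta> \<le> q" by (auto simp: \<delta>_def)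
    have evS: "eventually (\<lambda>n. \<forall>x\<in>S n. inner c x + \<epsilon> * norm x \<le> \<delta> * (1 + norm x)) sequentially"
      using S K \<epsilon> \<open>\<delta> > 0\<close> by (intro aw_converges_eventually_conical_bound[OF aw(1)]) simp_all
    have evT: "eventually (\<lambda>n. \<forall>x\<in>T n. inner (- c) x + 0 * norm x \<le> \<delta> * (1 + norm x)) sequentially"
      using T \<open>\<delta> > 0\<close> by (intro aw_converges_eventually_conical_bound[OF aw(2)]) simp_all
    have evz: "eventually (\<lambda>n. \<exists>z\<in>S n. dist 0 z < \<delta>) sequentially"
      using S K(1) \<open>\<delta> > 0\<close> by (intro aw_converges_eventually_near[OF aw(1)]) auto
    have evy: "eventually (\<lambda>n. \<exists>y\<in>T n. dist 0 y < \<delta>) sequentially"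
      using T \<open>\<delta> > 0\<close> by (intro aw_converges_eventually_near[OF aw(2)]) auto
    show ?thesis
      using evS eventually_sequentially_Suc[THEN iffD2, OF evT]
        eventually_sequentially_Suc[THEN iffD2, OF evz]
        eventually_sequentially_Suc[THEN iffD2, OF evy] eventually_ge_at_top[of 1]
    proof eventually_elim
      case (elim n)
      define R where "R = norm (a n)"
      define s where "s = norm (a n - b (Suc n))"
      obtain y where y: "y \<in> T (Suc n)" "norm y < \<delta>" using elim(4) by auto
      obtain z where z: "z \<in> S (Suc n)" "norm z < \<delta>" using elim(3) by auto
      define p where "p = norm (b (Suc n) - y)"
      have nay: "norm (a n - y) \<le> R + \<delta>"
        using norm_triangle_ineq4[of "a n" y] y(2) by (simp add: R_def)
      have "p\<^sup>2 + s\<^sup>2 \<le> (norm (a n - y))\<^sup>2"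
        unfolding p_def s_def b using T[of "Suc n"] y(1) by (intro metric_proj_pythagoras) auto
      also have "\<dots> \<le> (R + \<delta>)\<^sup>2" using nay by (intro power_mono) auto
      finally have pyth: "p\<^sup>2 + s\<^sup>2 \<le> (R + \<delta>)\<^sup>2" .
      have R: "R \<ge> 0" by (simp add: R_def)
      have "p\<^sup>2 \<le> (R + \<delta>)\<^sup>2" using pyth zero_le_power2[of s] by linarith
      then have "p \<le> R + \<delta>" by (rule power2_le_imp_le) (use R \<open>\<delta> > 0\<close> in auto)
      have bp: "norm (b (Suc n)) \<le> p + \<delta>"
        using norm_triangle_ineq[of "b (Suc n) - y" y] y(2) by (simp add: p_def)
      have "(norm (a (Suc n) - z))\<^sup>2 + (norm (b (Suc n) - a (Suc n)))\<^sup>2 \<le> (norm (b (Suc n) - z))\<^sup>2"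
        unfolding aSuc using S[of "Suc n"] z(1) by (intro metric_proj_pythagoras) auto
      then have "(norm (a (Suc n) - z))\<^sup>2 \<le> (norm (b (Suc n) - z))\<^sup>2"
        using zero_le_power2[of "norm (b (Suc n) - a (Suc n))"] by linarith
      then have "norm (a (Suc n) - z) \<le> norm (b (Suc n) - z)" by (rule power2_le_imp_le) simp
      then have ap: "norm (a (Suc n)) \<le> p + 3 * \<delta>"
        using norm_triangle_ineq[of "a (Suc n) - z" z] norm_triangle_ineq4[of "b (Suc n)" z] z(2) bp
        by simp
      \<comment> \<open>In the first case \<^term>\<open>inner c\<close> is at most a negative multiple of \<^term>\<open>R\<close> at \<^term>\<open>a n\<close> and
        nearly nonnegative at \<^term>\<open>b (Suc n)\<close>, up to small errors, which forces a long step. The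
        projection then gains \<^term>\<open>6 * \<theta> * R\<close>, half of which pays for the error
        \<^term>\<open>3 * \<delta>\<close>.\<close>
      have "norm (a (Suc n)) \<le> (1 - 3 * \<theta>) * R + \<eta>"
      proof (cases "R \<ge> q")
        case True
        have "inner c (a n) + \<epsilon> * R \<le> \<delta> * (1 + R)" using elim(1) aS[OF elim(5)] by (simp add: R_def)
        moreover have "- inner c (b (Suc n)) \<le> \<delta> * (1 + norm (b (Suc n)))"
          using elim(2) bT[of "Suc n"] by simp
        moreover have "\<delta> * (1 + norm (b (Suc n))) \<le> \<delta> * (3 + R)"
          using bp \<open>p \<le> R + \<delta>\<close> \<delta>(1) \<open>\<delta> > 0\<close> by (intro mult_left_mono) auto
        moreover have "inner c (b (Suc n) - a n) \<le> M * s"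
        proof -
          have "inner c (b (Suc n) - a n) \<le> norm c * s"
            using norm_cauchy_schwarz[of c "b (Suc n) - a n"] by (simp add: s_def norm_minus_commute)
          also have "\<dots> \<le> M * s" using M by (intro mult_right_mono) (auto simp: s_def)
          finally show ?thesis .
        qed
        moreover have "\<delta> * (8 * (1 + R)) \<le> \<epsilon> * R"
        proof -
          have "\<delta> * (8 * (1 + q)) \<le> \<epsilon> * q" using \<delta>(3) q by (simp add: pos_le_divide_eq)
          then have "\<delta> * (8 * (1 + q)) * R \<le> \<epsilon> * q * R" using R by (rule mult_right_mono)
          moreover have "\<delta> * (8 * (1 + R)) * q \<le> \<delta> * (8 * (1 + q)) * R"
            using \<open>\<delta> > 0\<close> True by (simp add: algebra_simps)
          ultimately have "\<delta> * (8 * (1 + R)) * q \<le> \<epsilon> * R * q" by (simp add: mult_ac)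
          then show ?thesis using q by simp
        qed
        moreover have "0 \<le> \<delta> * R" using \<open>\<delta> > 0\<close> R by simp
        ultimately have "\<epsilon> * R \<le> 2 * (M * s)"
          by (simp add: inner_diff_right algebra_simps)
        then have "M * (\<kappa> * R) \<le> M * s" using \<kappa>(3) by (simp add: algebra_simps flip: \<kappa>(3))
        then have "\<kappa> * R \<le> s" using M(1) by simp
        moreover have dR: "\<delta> \<le> \<theta> * R" using \<delta>(2) mult_left_mono[OF True, of \<theta>] \<theta>(1) by linarith
        ultimately have "p \<le> (1 - 6 * \<theta>) * R"
          using pyth R \<kappa> \<open>\<delta> > 0\<close> by (intro pythagorean_contraction[OF _ _ _ _ _ \<theta>_def]) auto
        then show ?thesis using ap dR \<eta> by (simp add: algebra_simps)
      next
        case False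
        have "0 \<le> (1 - 3 * \<theta>) * R" using \<theta> R by simp
        moreover have "norm (a (Suc n)) \<le> R + 4 * \<delta>" using ap \<open>p \<le> R + \<delta>\<close> by simp
        ultimately show ?thesis using False \<delta>(4) q by (simp add: q_def)
      qed
      moreover have "norm (b (Suc n)) \<le> R + \<eta>"
        using bp \<open>p \<le> R + \<delta>\<close> \<delta>(4) q by (simp add: q_def)
      ultimately show ?case by (simp add: R_def)
    qed
  qed
  have a0: "(\<lambda>n. norm (a n)) \<longlonglongrightarrow> 0"
  proof (rule tendsto_zero_if_contractive_up_to_error[of _ "1 - 3 * \<theta>"])
    show "eventually (\<lambda>n. norm (a (Suc n)) \<le> (1 - 3 * \<theta>) * norm (a n) + \<eta>) sequentially"
      if "\<eta> > 0" for \<eta> using main[OF that] by eventually_elim auto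
  qed (use \<theta> in auto)
  have "(\<lambda>n. norm (b (Suc n))) \<longlonglongrightarrow> 0"
  proof (rule order_tendstoI)
    fix e :: real assume "e > 0"
    then have "e / 2 > 0" by simp
    show "eventually (\<lambda>n. norm (b (Suc n)) < e) sequentially"
      using main[OF \<open>e / 2 > 0\<close>] order_tendstoD(2)[OF a0 \<open>e / 2 > 0\<close>] by eventually_elim auto
  qed (simp add: less_le_trans)
  then have "b \<longlonglongrightarrow> 0" by (rule LIMSEQ_imp_Suc[OF tendsto_norm_zero_cancel])
  moreover have "a \<longlonglongrightarrow> 0" using a0 by (rule tendsto_norm_zero_cancel)
  ultimately show ?thesis unfolding convergent_def by blast
qed

theorem theorem4p5:
  fixes K B :: "'a::{real_inner,complete_space} set"
  assumes "closed K" and "convex_cone K"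
    and "(interior K \<noteq> {} \<and>
          (\<exists>n a b. n \<ge> (1::nat) \<and> (\<forall>i\<in>{1..n}. b i > (0::real)) \<and>
             B = {x. \<forall>i\<in>{1..n}. inner (a i) x \<le> b i}))
       \<or> (interior K \<noteq> {} \<and>
          (\<exists>a b. a \<notin> neg_polar K \<and> B = {x. inner a x \<ge> b}))
       \<or> (\<exists>a. a \<in> interior (neg_polar K) \<and> B = {x. inner a x \<ge> 0})"
  shows "stable_couple K B"
proof -
  have K: "convex K" "0 \<in> K" using assms(2) by (auto simp: convex_cone_def convex_cone_contains_0)
  consider
    (polyhedron) n a b where "interior K \<noteq> {}" "\<forall>i\<in>{1..n::nat}. b i > (0::real)"
      "B = {x. \<forall>i\<in>{1..n}. inner (a i) x \<le> b i}"
    | (halfspace) a b where "interior K \<noteq> {}" "a \<notin> neg_polar K" "B = {x. inner a x \<ge> b}"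
    | (polar) a where "a \<in> interior (neg_polar K)" "B = {x. inner a x \<ge> 0}"
    using assms(3) by blast
  then show ?thesis
  proof cases
    case polyhedron
    have B: "B = (\<Inter>i\<in>{1..n}. {x. inner (a i) x \<le> b i})" using polyhedron(3) by auto
    have "open (\<Inter>i\<in>{1..n}. {x. inner (a i) x < b i})"
      by (intro open_INT) (auto intro: open_halfspace_lt)
    moreover have "0 \<in> (\<Inter>i\<in>{1..n}. {x. inner (a i) x < b i})" using polyhedron(2) by auto
    moreover have "(\<Inter>i\<in>{1..n}. {x. inner (a i) x < b i}) \<subseteq> B"
      unfolding B by (intro INT_anti_mono) (auto intro: less_imp_le)
    ultimately have "0 \<in> interior B" by (rule interiorI)
    then have "interior (K \<inter> B) \<noteq> {}"
      by (rule cone_Int_nhd_interior_nonempty[OF assms(2) polyhedron(1)])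
    moreover have "closed B" unfolding B by (intro closed_INT ballI closed_halfspace_le)
    moreover have "convex B" unfolding B by (intro convex_INT convex_halfspace_le)
    ultimately show ?thesis using assms(1) K(1) by (intro stable_couple_if_interior_Int_nonempty)
  next
    case halfspace
    then show ?thesis
      using cone_Int_halfspace_interior_nonempty[OF assms(2)] assms(1) K(1)
      by (intro stable_couple_if_interior_Int_nonempty)
        (auto simp: closed_halfspace_ge convex_halfspace_ge)
  next
    case polar
    obtain \<epsilon> where "\<epsilon> > 0" "\<And>k. k \<in> K \<Longrightarrow> inner a k + \<epsilon> * norm k \<le> 0"
      using neg_polar_interior_bound[OF polar(1)] by blast
    then have "convergent x \<and> convergent y"
      if "\<forall>n\<ge>1. S n \<noteq> {} \<and> closed (S n) \<and> convex (S n)"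
        "\<forall>n\<ge>1. T n \<noteq> {} \<and> closed (T n) \<and> convex (T n)"
        "aw_converges S K" "aw_converges T B" "perturbed_ap S T a0 x y" for S T a0 x y
      using that K(2) unfolding polar(2)
      by (intro perturbed_ap_convergent_if_polar_halfspace[of S T K a \<epsilon> a0 x y]) auto
    moreover have "closed B" "convex B" "0 \<in> B"
      unfolding polar(2) by (auto simp: closed_halfspace_ge convex_halfspace_ge)
    ultimately show ?thesis
      unfolding stable_couple_def using assms(1) K by blast
  qed
qed

end
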